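(* Let $d\ge 1$ and $t\ge 2$ be fixed integers. For any $\mathcal{E} \subseteq \mathbb{F}_q \times \mathbb{F}_q^d$ and any non-degenerate bilinear form $B(\cdot,\cdot)$ on $\mathbb{F}_q^d$, consider the system of $\binom{t}{2}$ equations $$a_i + a_j + \lambda_{ij} = B(\boldsymbol{b}_i, \boldsymbol{b}_j)\quad (1\le i<j\le t),\qquad (a_i,\boldsymbol{b}_i) \in \mathcal{E},\ 1 \le i \le t,$$ with parameters $\lambda_{ij}\in\mathbb{F}_q$. (i) Suppose that $|\mathcal{E}| \gg q^{\frac{d}{2}+t-1}$. Then the number of solutions of the system is $$(1+o(1)) \frac{|\mathcal{E}|^t}{q^{\binom{t}{2}}}.$$ (ii) If $|\mathcal{E}| \gg q^{(d+t)/2}$, then the system is solvable for $(1-o(1)) q^{\binom{t}{2}}$ possible choices of $(\lambda_{ij})_{1\le i<j\le t}$ with $\lambda_{ij} \in \mathbb{F}_q$.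
   Context: $q$ is a power of an odd prime, viewed as an asymptotic parameter: $q\to\infty$, the set $\mathcal{E}$ and the form $B$ may depend on $q$, and $o(1)$ denotes a quantity tending to $0$ as $q\to\infty$. $X \ll Y$ (equivalently $Y \gg X$) means $X = o(Y)$. *)

theory Defs
  imports "HOL-Algebra.Algebra" "HOL-Library.Landau_Symbols"
begin

text \<open>The limit \<open>q \<rightarrow> \<infinity>\<close> runs over varying fields, so the fields are ring records
  (with explicit carriers inside one type) rather than instances of a type class.\<close>

definition odd_finite_field :: "('a, 'm) ring_scheme \<Rightarrow> bool" where
  "odd_finite_field F \<longleftrightarrow>
     field F \<and> finite (carrier F) \<and>
     (\<exists>p k :: nat. Factorial_Ring.prime p \<and> odd p \<and> k \<ge> 1 \<and> order F = p ^ k)"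

text \<open>\<open>coord_space F d\<close> is \<open>F\<^sup>d\<close> as an \<open>F\<close>-module; its vectors are the functions that are
  \<open>undefined\<close> outside \<open>{1..d}\<close>. The multiplicative fields of the record play no role.\<close>

definition coord_space :: "('a, 'm) ring_scheme \<Rightarrow> nat \<Rightarrow> ('a, nat \<Rightarrow> 'a) module" where
  "coord_space F d =
     \<lparr>carrier = {1..d} \<rightarrow>\<^sub>E carrier F,
      monoid.mult = undefined,
      monoid.one = undefined,
      ring.zero = (\<lambda>i\<in>{1..d}. \<zero>\<^bsub>F\<^esub>),
      ring.add = (\<lambda>u v. \<lambda>i\<in>{1..d}. u i \<oplus>\<^bsub>F\<^esub> v i),
      module.smult = (\<lambda>c u. \<lambda>i\<in>{1..d}. c \<otimes>\<^bsub>F\<^esub> u i)\<rparr>"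

lemma coord_space_module:
  fixes F (structure)
  assumes "cring F"
  shows "module F (coord_space F d)"
proof -
  interpret cring F by fact
  show ?thesis
  proof (rule moduleI)
    show "abelian_group (coord_space F d)"
    proof (rule abelian_groupI)
      fix x assume x: "x \<in> carrier (coord_space F d)"
      then have "x i \<in> carrier F" if "i \<in> {1..d}" for i
        using that by (auto simp: coord_space_def PiE_iff)
      with x show "\<exists>y\<in>carrier (coord_space F d).
          y \<oplus>\<^bsub>coord_space F d\<^esub> x = \<zero>\<^bsub>coord_space F d\<^esub>"
        by (intro bexI[of _ "\<lambda>i\<in>{1..d}. \<ominus> x i"])
          (auto simp: coord_space_def l_neg intro!: restrict_ext)
    qed (auto simp: coord_space_def PiE_iff extensional_def fun_eq_iff a_ac)
  qed (auto simp: coord_space_def PiE_iff extensional_def fun_eq_iff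
      l_distr r_distr m_assoc assms)
qed

definition bilinear_form ::
  "('a, 'm) ring_scheme \<Rightarrow> ('a, 'v, 'n) module_scheme \<Rightarrow> ('v \<Rightarrow> 'v \<Rightarrow> 'a) \<Rightarrow> bool" where
  "bilinear_form F V B \<longleftrightarrow>
     (\<forall>u\<in>carrier V. \<forall>v\<in>carrier V. B u v \<in> carrier F) \<and>
     (\<forall>u\<in>carrier V. \<forall>v\<in>carrier V. \<forall>w\<in>carrier V.
        B (u \<oplus>\<^bsub>V\<^esub> v) w = B u w \<oplus>\<^bsub>F\<^esub> B v w \<and>
        B u (v \<oplus>\<^bsub>V\<^esub> w) = B u v \<oplus>\<^bsub>F\<^esub> B u w) \<and>
     (\<forall>c\<in>carrier F. \<forall>u\<in>carrier V. \<forall>v\<in>carrier V.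
        B (c \<odot>\<^bsub>V\<^esub> u) v = c \<otimes>\<^bsub>F\<^esub> B u v \<and>
        B u (c \<odot>\<^bsub>V\<^esub> v) = c \<otimes>\<^bsub>F\<^esub> B u v)"

definition nondegenerate ::
  "('a, 'm) ring_scheme \<Rightarrow> ('a, 'v, 'n) module_scheme \<Rightarrow> ('v \<Rightarrow> 'v \<Rightarrow> 'a) \<Rightarrow> bool" where
  "nondegenerate F V B \<longleftrightarrow>
     (\<forall>u\<in>carrier V. (\<forall>v\<in>carrier V. B u v = \<zero>\<^bsub>F\<^esub>) \<longrightarrow> u = \<zero>\<^bsub>V\<^esub>) \<and>
     (\<forall>v\<in>carrier V. (\<forall>u\<in>carrier V. B u v = \<zero>\<^bsub>F\<^esub>) \<longrightarrow> v = \<zero>\<^bsub>V\<^esub>)"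

definition parameters :: "('a, 'm) ring_scheme \<Rightarrow> nat \<Rightarrow> (nat \<times> nat \<Rightarrow> 'a) set" where
  "parameters F t = {(i, j). 1 \<le> i \<and> i < j \<and> j \<le> t} \<rightarrow>\<^sub>E carrier F"

definition solutions ::
  "('a, 'm) ring_scheme \<Rightarrow> nat \<Rightarrow> ('a \<times> 'v) set \<Rightarrow> ('v \<Rightarrow> 'v \<Rightarrow> 'a) \<Rightarrow>
   (nat \<times> nat \<Rightarrow> 'a) \<Rightarrow> (nat \<Rightarrow> 'a \<times> 'v) set" where
  "solutions F t E B l =
     {x \<in> {1..t} \<rightarrow>\<^sub>E E. \<forall>i j. 1 \<le> i \<and> i < j \<and> j \<le> t \<longrightarrow>
        fst (x i) \<oplus>\<^bsub>F\<^esub> fst (x j) \<oplus>\<^bsub>F\<^esub> l (i, j) = B (snd (x i)) (snd (x j))}"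

end

theory Submission
  imports Defs "HOL-Analysis.Convex"
begin

text \<open>
  Writing \<open>label (a, b) (a', b') = B b b' - (a + a')\<close>, the system prescribes a label
  \<open>\<lambda>\<^sub>i\<^sub>j\<close> for every pair \<open>(x\<^sub>i, x\<^sub>j)\<close> of a tuple of \<open>t\<close> points of \<open>E\<close>. Put
  \<open>q = |F|\<close>, \<open>m = |E|\<close> and \<open>K = q\<^sup>d\<close>. The form enters through one fact only: for each
  label \<open>c\<close>, the bipartite graph of the pairs with label \<open>c\<close> on \<open>F \<times> F\<^sup>d\<close> is pseudo-random. All its
  degrees are \<open>K\<close>, and two distinct points have at most \<open>K / q\<close> common neighbours, because
  these correspond to the solutions \<open>b\<close> of an affine equation \<open>B b w = s\<close>. Expanding
  a square gives (\<open>label_degree_variance\<close>)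
  \<open>\<Sum>\<^sub>x (|{y \<in> S. label x y = c}| - |S| / q)\<^sup>2 \<le> K |S|\<close> for every set \<open>S\<close> of points. The rest
  is combinatorics of labellings with this property; it treats arbitrary sets \<open>H\<close> of prescribed
  pairs (edges) on a vertex set \<open>V\<close>, so that edges can be removed or added one at a time. The
  expected number of solutions is \<open>m ^ |V| / q ^ |H|\<close>.

  For fixed labels (\<open>count_close_to_expected\<close>), removing an edge \<open>(u, v)\<close> should multiply the
  count by \<open>q\<close>. When the points at the vertices other than \<open>u\<close> and \<open>v\<close> are fixed, the remaining
  equations confine \<open>x\<^sub>u\<close> and \<open>x\<^sub>v\<close> to two sets that do not depend on each other, and the expander
  mixing inequality bounds the error for these. Summation by Cauchy-Schwarz bounds the total error by
  \<open>sqrt (K N\<^sub>u N\<^sub>v)\<close>, where \<open>N\<^sub>w\<close> is the count for the graph without the vertex \<open>w\<close>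
  (\<open>count_remove_edge\<close>). By induction \<open>N\<^sub>w\<close> has its expected size. As \<open>w\<close> carries
  at most \<open>t - 1\<close> edges, the relative error of the step is a constant times
  \<open>sqrt K q ^ (t - 1) / m\<close>, which tends to zero exactly under the hypothesis of the first claim.

  For almost all labels (\<open>discrepancy_le\<close>), the quantity to control is the sum over all label
  vectors \<open>\<lambda>\<close> of the distance between the count and its expectation. Adding an edge \<open>(u, v)\<close>
  increases it by at most \<open>m ^ (t - 1) sqrt (K q ^ t)\<close>: the points at the vertices other than \<open>v\<close>
  determine all labels away from \<open>v\<close>, so that only the labels at \<open>v\<close> remain free, and the classes
  into which these labels partition the choices of \<open>x\<^sub>v\<close> have total size \<open>m\<close>
  (\<open>discrepancy_insert\<close>). Each unsolvable \<open>\<lambda>\<close> contributes the full expectation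
  \<open>m ^ t / q ^ |H|\<close>, so the proportion of such \<open>\<lambda>\<close> is at most a constant times
  \<open>sqrt (K q ^ t) / m\<close>, which tends to zero under the hypothesis of the second claim.
\<close>

section \<open>Finite sums\<close>

lemma sum_PiE_insert:
  assumes "i \<notin> I"
  shows "(\<Sum>x\<in>PiE (insert i I) A. f x) = (\<Sum>z\<in>PiE I A. \<Sum>y\<in>A i. f (z(i := y)))"
proof -
  have "(\<Sum>x\<in>PiE (insert i I) A. f x) = (\<Sum>(y, z)\<in>A i \<times> PiE I A. f (z(i := y)))"
    unfolding PiE_insert_eq
    by (subst sum.reindex[OF inj_combinator[OF assms]]) (simp add: case_prod_unfold o_def)
  also have "\<dots> = (\<Sum>z\<in>PiE I A. \<Sum>y\<in>A i. f (z(i := y)))"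
    by (subst sum.swap) (simp add: sum.cartesian_product)
  finally show ?thesis .
qed

lemma sum_PiE_Un:
  assumes "I \<inter> J = {}"
  shows "(\<Sum>x\<in>PiE (I \<union> J) A. f x)
    = (\<Sum>y\<in>PiE I A. \<Sum>z\<in>PiE J A. f (\<lambda>i. if i \<in> I then y i else z i))"
proof -
  have "(\<Sum>x\<in>PiE (I \<union> J) A. f x)
      = (\<Sum>(y, z)\<in>PiE I A \<times> PiE J A. f (\<lambda>i. if i \<in> I then y i else z i))"
    using assms
    by (intro sum.reindex_bij_witness[where i = "\<lambda>(y, z) i. if i \<in> I then y i else z i"
          and j = "\<lambda>x. (restrict x I, restrict x J)"])
      (auto simp: PiE_iff extensional_def fun_eq_iff restrict_def intro!: arg_cong[of _ _ f])
  then show ?thesis by (simp add: sum.cartesian_product)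
qed

lemma sum_card_fibres:
  assumes "finite A" and "finite C" and "\<And>x. x \<in> A \<Longrightarrow> f x \<in> C"
  shows "(\<Sum>c\<in>C. real (card {x \<in> A. f x = c})) = real (card A)"
proof -
  have "f ` A \<subseteq> C" using assms(3) by auto
  from sum.group[OF assms(1,2) this, of "\<lambda>_. 1::real"] show ?thesis by simp
qed

lemma Cauchy_Schwarz_sum_abs:
  fixes f g :: "'i \<Rightarrow> real"
  assumes "(\<Sum>i\<in>I. (f i)\<^sup>2) \<le> a" "(\<Sum>i\<in>I. (g i)\<^sup>2) \<le> b"
  shows "(\<Sum>i\<in>I. \<bar>f i * g i\<bar>) \<le> sqrt (a * b)"
proof -
  have "(\<Sum>i\<in>I. \<bar>f i * g i\<bar>)\<^sup>2 \<le> (\<Sum>i\<in>I. (f i)\<^sup>2) * (\<Sum>i\<in>I. (g i)\<^sup>2)"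
    using Cauchy_Schwarz_ineq_sum[of "\<lambda>i. \<bar>f i\<bar>" "\<lambda>i. \<bar>g i\<bar>" I] by (simp add: abs_mult)
  also have "\<dots> \<le> a * b"
    using assms by (intro mult_mono order_trans[OF sum_nonneg assms(1)] sum_nonneg) auto
  finally show ?thesis by (rule real_le_rsqrt)
qed

section \<open>Edges on an ordered vertex set\<close>

definition pairs :: "'v::linorder set \<Rightarrow> ('v \<times> 'v) set" where
  "pairs V = {(i, j). i \<in> V \<and> j \<in> V \<and> i < j}"

definition edges_at :: "'v \<Rightarrow> ('v \<times> 'v) set \<Rightarrow> ('v \<times> 'v) set" where
  "edges_at v H = {e \<in> H. fst e = v \<or> snd e = v}"

definition edges_off :: "'v \<Rightarrow> ('v \<times> 'v) set \<Rightarrow> ('v \<times> 'v) set" where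
  "edges_off v H = {e \<in> H. fst e \<noteq> v \<and> snd e \<noteq> v}"

lemma finite_pairs: "finite V \<Longrightarrow> finite (pairs V)"
  by (rule finite_subset[of _ "V \<times> V"]) (auto simp: pairs_def)

lemma edges_at_un_off: "edges_at v H \<union> edges_off v H = H" "edges_at v H \<inter> edges_off v H = {}"
  by (auto simp: edges_at_def edges_off_def)

lemma edges_off_pairs: "H \<subseteq> pairs V \<Longrightarrow> edges_off v H \<subseteq> pairs (V - {v})"
  by (auto simp: edges_off_def pairs_def)

text \<open>
  Sending an edge at \<open>v\<close> to its other end is injective: \<open>pairs V\<close> contains each unordered pair
  in its increasing order only.
\<close>

lemma card_edges_at_le:
  assumes "finite V" "H \<subseteq> pairs V" "v \<in> V"
  shows "card (edges_at v H) \<le> card V - 1"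
proof -
  have "card (edges_at v H) \<le> card (V - {v})"
  proof (rule card_inj_on_le)
    show "inj_on (\<lambda>e. if fst e = v then snd e else fst e) (edges_at v H)"
    proof -
      have "i < j" if "(i, j) \<in> H" for i j
        using that assms(2) by (auto simp: pairs_def)
      then have "(j, i) \<notin> H" if "(i, j) \<in> H" for i j
        using that order.asym by blast
      then show ?thesis
        by (auto simp: inj_on_def edges_at_def split: if_splits)
    qed
    show "(\<lambda>e. if fst e = v then snd e else fst e) ` edges_at v H \<subseteq> V - {v}"
      using assms(2) by (auto simp: edges_at_def pairs_def)
  qed (use assms in simp)
  then show ?thesis using assms by simp
qed

lemma card_pairs: "card (pairs {1..t}) = t choose 2"
proof (induction t)
  case 0
  then show ?case by (simp add: pairs_def)
next
  case (Suc t)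
  have "pairs {1..Suc t} = pairs {1..t} \<union> (\<lambda>i. (i, Suc t)) ` {1..t}"
    by (auto simp: pairs_def image_iff)
  moreover have "pairs {1..t} \<inter> (\<lambda>i. (i, Suc t)) ` {1..t} = {}"
    by (auto simp: pairs_def)
  ultimately have "card (pairs {1..Suc t}) = card (pairs {1..t}) + card ((\<lambda>i. (i, Suc t)) ` {1..t})"
    by (simp add: card_Un_disjoint finite_pairs)
  also have "\<dots> = (t choose 2) + t"
    using Suc by (simp add: card_image inj_on_def)
  finally show ?case by (simp add: numeral_2_eq_2)
qed

section \<open>Uniform labellings\<close>

text \<open>
  Pseudo-randomness is required of the graph of each label in a form that is inherited by subsets of
  a larger point set: from a typical point \<open>x\<close>, a label occurs into \<open>S\<close> with density
  \<open>1 / |C|\<close>. The constant \<open>K\<close> plays the role of the squared second eigenvalue of an expander.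
\<close>

locale uniform_labelling =
  fixes E :: "'x set" and C :: "'c set" and lab :: "'x \<Rightarrow> 'x \<Rightarrow> 'c" and K :: real
  assumes finite_E: "finite E" and finite_C: "finite C" and C_nonempty: "C \<noteq> {}"
    and K_nonneg: "K \<ge> 0"
    and degree_variance: "\<And>S c. S \<subseteq> E \<Longrightarrow> c \<in> C \<Longrightarrow>
      (\<Sum>x\<in>E. (real (card {y \<in> S. lab x y = c}) - card S / card C)\<^sup>2) \<le> K * card S"
begin

abbreviation q :: real where "q \<equiv> card C"

abbreviation m :: real where "m \<equiv> card E"

lemma q_ge_1: "q \<ge> 1"
  using finite_C C_nonempty by (simp add: card_gt_0_iff Suc_le_eq)

definition sat :: "('v \<times> 'v) set \<Rightarrow> ('v \<Rightarrow> 'x) \<Rightarrow> ('v \<times> 'v \<Rightarrow> 'c) \<Rightarrow> bool" where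
  "sat H x l \<longleftrightarrow> (\<forall>e\<in>H. lab (x (fst e)) (x (snd e)) = l e)"

definition count :: "'v set \<Rightarrow> ('v \<times> 'v) set \<Rightarrow> ('v \<times> 'v \<Rightarrow> 'c) \<Rightarrow> real" where
  "count V H l = card {x \<in> V \<rightarrow>\<^sub>E E. sat H x l}"

definition expected :: "'v set \<Rightarrow> ('v \<times> 'v) set \<Rightarrow> real" where
  "expected V H = m ^ card V / q ^ card H"

lemma sat_Un: "sat (H \<union> H') x l \<longleftrightarrow> sat H x l \<and> sat H' x l"
  by (auto simp: sat_def)

lemma sat_insert: "sat (insert e H) x l \<longleftrightarrow> lab (x (fst e)) (x (snd e)) = l e \<and> sat H x l"
  by (auto simp: sat_def)

lemma sat_cong:
  assumes "\<And>e. e \<in> H \<Longrightarrow> x (fst e) = x' (fst e)" "\<And>e. e \<in> H \<Longrightarrow> x (snd e) = x' (snd e)"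
    "\<And>e. e \<in> H \<Longrightarrow> l e = l' e"
  shows "sat H x l = sat H x' l'"
  using assms by (auto simp: sat_def)

lemma count_eq_sum:
  assumes "finite V"
  shows "count V H l = (\<Sum>x\<in>V \<rightarrow>\<^sub>E E. of_bool (sat H x l))"
proof -
  have "finite (V \<rightarrow>\<^sub>E E)" using assms finite_E by (simp add: finite_PiE)
  then show ?thesis by (simp add: count_def Int_def)
qed

text \<open>The expander mixing inequality: Cauchy-Schwarz applied to the degree deviations on \<open>S\<close>.\<close>

lemma mixing:
  assumes S: "S \<subseteq> E" and T: "T \<subseteq> E" and c: "c \<in> C"
  shows "\<bar>real (card {(x, y) \<in> S \<times> T. lab x y = c}) - card S * card T / q\<bar>
    \<le> sqrt K * sqrt (card S) * sqrt (card T)"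
proof -
  have fin: "finite S" "finite T" using S T finite_E finite_subset by blast+
  let ?g = "\<lambda>x. real (card {y \<in> T. lab x y = c}) - card T / q"
  have "{(x, y) \<in> S \<times> T. lab x y = c} = (SIGMA x:S. {y \<in> T. lab x y = c})"
    by auto
  then have "real (card {(x, y) \<in> S \<times> T. lab x y = c}) - card S * card T / q = (\<Sum>x\<in>S. ?g x)"
    using fin by (simp add: card_SigmaI sum_subtractf)
  also have "\<bar>\<dots>\<bar> \<le> (\<Sum>x\<in>S. \<bar>1 * ?g x\<bar>)"
    by (simp add: sum_abs)
  also have "\<dots> \<le> sqrt (card S * (K * card T))"
  proof (rule Cauchy_Schwarz_sum_abs)
    have "(\<Sum>x\<in>S. (?g x)\<^sup>2) \<le> (\<Sum>x\<in>E. (?g x)\<^sup>2)"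
      using S finite_E by (intro sum_mono2) auto
    also have "\<dots> \<le> K * card T" by (rule degree_variance[OF T c])
    finally show "(\<Sum>x\<in>S. (?g x)\<^sup>2) \<le> K * card T" .
  qed simp
  finally show ?thesis by (simp add: real_sqrt_mult mult_ac)
qed

text \<open>
  The error of removing one edge is measured by the counts for the two graphs with one end vertex
  removed. With the points \<open>z\<close> at the other vertices fixed, the admissible points for \<open>u\<close> and for
  \<open>v\<close> form sets \<open>S z\<close> and \<open>T z\<close> that do not depend on each other, because \<open>(u, v)\<close> is the only edge
  between \<open>u\<close> and \<open>v\<close>. The sizes of these sets add up, over \<open>z\<close>, to the counts without \<open>v\<close>
  and without \<open>u\<close>, so the errors from the mixing inequality combine by Cauchy-Schwarz.
\<close>

lemma count_remove_edge:
  fixes V :: "'v::linorder set"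
  assumes V: "finite V" and H: "H \<subseteq> pairs V" and e: "(u, v) \<in> H" and l: "l (u, v) \<in> C"
  shows "\<bar>count V H l - count V (H - {(u, v)}) l / q\<bar>
    \<le> sqrt K * sqrt (count (V - {u}) (edges_off u H) l * count (V - {v}) (edges_off v H) l)"
proof -
  have uv: "u \<in> V" "v \<in> V" "u < v" using e H by (auto simp: pairs_def)
  define W where "W = V - {u, v}"
  have W: "finite W" "u \<notin> W" "v \<notin> W" "u \<noteq> v" "V - {u} = insert v W" "V - {v} = insert u W"
    "V = insert u (insert v W)" "u \<notin> insert v W"
    using uv V by (auto simp: W_def)
  define H0 Hu Hv where "H0 = edges_off u (edges_off v H)"
    and "Hu = edges_at u (edges_off v H)" and "Hv = edges_at v (edges_off u H)"
  have Hsplit: "H - {(u, v)} = H0 \<union> Hu \<union> Hv" "edges_off v H = H0 \<union> Hu" "edges_off u H = H0 \<union> Hv"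
    using H uv by (auto simp: H0_def Hu_def Hv_def edges_at_def edges_off_def pairs_def)
  have Heq: "H = insert (u, v) (H0 \<union> Hu \<union> Hv)" using Hsplit(1) e by blast
  have at: "fst e \<noteq> v \<and> snd e \<noteq> v" if "e \<in> H0 \<union> Hu" for e
    using that by (auto simp: H0_def Hu_def edges_at_def edges_off_def)
  have at': "fst e \<noteq> u \<and> snd e \<noteq> u" if "e \<in> H0 \<union> Hv" for e
    using that by (auto simp: H0_def Hv_def edges_at_def edges_off_def)
  \<comment> \<open>The edges inside \<open>W\<close> are counted in both sets; this makes a set empty if \<open>z\<close> violates them.\<close>
  define S T where "S z = {x \<in> E. sat (H0 \<union> Hu) (z(u := x)) l}"
    and "T z = {y \<in> E. sat (H0 \<union> Hv) (z(v := y)) l}" for z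
  have ST: "S z \<subseteq> E" "T z \<subseteq> E" "finite (S z)" "finite (T z)" for z
    using finite_E by (auto simp: S_def T_def)
  have satS: "sat (H0 \<union> Hu) (z(v := y, u := x)) l = sat (H0 \<union> Hu) (z(u := x)) l" for x y z
    using at by (intro sat_cong) auto
  have satT: "sat (H0 \<union> Hv) (z(v := y, u := x)) l = sat (H0 \<union> Hv) (z(v := y)) l" for x y z
    using at' by (intro sat_cong) auto
  have sat_rest: "sat (H0 \<union> Hu \<union> Hv) (z(v := y, u := x)) l \<longleftrightarrow> x \<in> S z \<and> y \<in> T z"
    if "x \<in> E" "y \<in> E" for x y z
    using that satS[of z y x] satT[of z y x] by (auto simp: S_def T_def sat_Un)
  have ob: "(\<Sum>y\<in>E. \<Sum>x\<in>E. of_bool (x \<in> S z \<and> y \<in> T z \<and> Q x y))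
      = real (card {(x, y) \<in> S z \<times> T z. Q x y})" for Q z
  proof -
    have "(\<Sum>y\<in>E. \<Sum>x\<in>E. of_bool (x \<in> S z \<and> y \<in> T z \<and> Q x y))
        = (\<Sum>x\<in>E. \<Sum>y\<in>E. of_bool (x \<in> S z \<and> y \<in> T z \<and> Q x y) :: real)"
      by (rule sum.swap)
    also have "\<dots> = (\<Sum>p\<in>E \<times> E. of_bool (fst p \<in> S z \<and> snd p \<in> T z \<and> Q (fst p) (snd p)))"
      by (simp only: sum.cartesian_product case_prod_unfold)
    also have "\<dots> = real (card (E \<times> E \<inter> {p. fst p \<in> S z \<and> snd p \<in> T z \<and> Q (fst p) (snd p)}))"
      using finite_E by (simp only: sum_of_bool_eq finite_cartesian_product)
    also have "E \<times> E \<inter> {p. fst p \<in> S z \<and> snd p \<in> T z \<and> Q (fst p) (snd p)}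
        = {(x, y) \<in> S z \<times> T z. Q x y}"
      using ST by auto
    finally show ?thesis .
  qed
  let ?Z = "W \<rightarrow>\<^sub>E E"
  have cH: "count V H l = (\<Sum>z\<in>?Z. real (card {(x, y) \<in> S z \<times> T z. lab x y = l (u, v)}))"
  proof -
    have "count V H l
        = (\<Sum>z\<in>?Z. \<Sum>y\<in>E. \<Sum>x\<in>E. of_bool (sat H (z(v := y, u := x)) l))"
      using V W by (subst W(7)) (simp add: count_eq_sum sum_PiE_insert)
    also have "\<dots> = (\<Sum>z\<in>?Z. \<Sum>y\<in>E. \<Sum>x\<in>E.
        of_bool (x \<in> S z \<and> y \<in> T z \<and> lab x y = l (u, v)))"
      using W(4) by (intro sum.cong refl) (subst Heq, auto simp: sat_insert sat_rest)
    finally show ?thesis by (simp only: ob)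
  qed
  have cH': "count V (H - {(u, v)}) l = (\<Sum>z\<in>?Z. real (card (S z) * card (T z)))"
  proof -
    have "count V (H - {(u, v)}) l
        = (\<Sum>z\<in>?Z. \<Sum>y\<in>E. \<Sum>x\<in>E. of_bool (sat (H0 \<union> Hu \<union> Hv) (z(v := y, u := x)) l))"
      unfolding Hsplit using V W by (subst W(7)) (simp add: count_eq_sum sum_PiE_insert)
    also have "\<dots> = (\<Sum>z\<in>?Z. \<Sum>y\<in>E. \<Sum>x\<in>E. of_bool (x \<in> S z \<and> y \<in> T z \<and> True))"
      by (intro sum.cong refl) (simp add: sat_rest)
    also have "\<dots> = (\<Sum>z\<in>?Z. real (card (S z) * card (T z)))"
      unfolding ob by (simp add: card_cartesian_product)
    finally show ?thesis .
  qed
  have cv: "count (V - {v}) (edges_off v H) l = (\<Sum>z\<in>?Z. real (card (S z)))"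
    unfolding W(6) Hsplit using W finite_E
    by (simp add: count_eq_sum sum_PiE_insert S_def Int_def conj_commute)
  have cu: "count (V - {u}) (edges_off u H) l = (\<Sum>z\<in>?Z. real (card (T z)))"
    unfolding W(5) Hsplit using W finite_E
    by (simp add: count_eq_sum sum_PiE_insert T_def Int_def conj_commute)
  have "\<bar>count V H l - count V (H - {(u, v)}) l / q\<bar>
      = \<bar>\<Sum>z\<in>?Z. real (card {(x, y) \<in> S z \<times> T z. lab x y = l (u, v)})
          - real (card (S z)) * real (card (T z)) / q\<bar>"
    by (simp add: cH cH' sum_subtractf sum_divide_distrib)
  also have "\<dots> \<le> (\<Sum>z\<in>?Z. sqrt K * sqrt (card (S z)) * sqrt (card (T z)))"
    using mixing[OF ST(1,2) l] by (intro order_trans[OF sum_abs] sum_mono) simp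
  also have "\<dots> = sqrt K * (\<Sum>z\<in>?Z. \<bar>sqrt (card (T z)) * sqrt (card (S z))\<bar>)"
    by (simp add: sum_distrib_left mult_ac)
  also have "\<dots> \<le> sqrt K * sqrt (count (V - {u}) (edges_off u H) l * count (V - {v}) (edges_off v H) l)"
    by (intro mult_left_mono Cauchy_Schwarz_sum_abs) (simp_all add: cu cv K_nonneg)
  finally show ?thesis .
qed

lemma count_no_edges: "count V {} l = m ^ card V" if "finite V"
  using that by (simp add: count_def sat_def card_PiE)

lemma expected_nonneg: "expected V H \<ge> 0"
  by (simp add: expected_def)

text \<open>
  One edge costs a relative error \<open>2 ^ (|H| - 1) \<delta>\<close>, so the errors add up to the geometric sum
  \<open>2 ^ |H| - 1\<close>. The induction varies the vertex set as well as the edges, because the bound for the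
  step refers to the graphs with a vertex removed; these have fewer edges, as both vertices lie
  on the removed edge. For these graphs the crude consequence \<open>count \<le> 2 ^ |H| * expected\<close> of
  \<open>\<delta> \<le> 1\<close> suffices.
\<close>

lemma count_close_to_expected:
  fixes V :: "'v::linorder set" and \<delta> :: real
  assumes "finite V" "H \<subseteq> pairs V" "card V \<le> t" "\<And>e. e \<in> H \<Longrightarrow> l e \<in> C"
    and \<delta>: "sqrt K * q ^ (t - 1) \<le> \<delta> * m" "0 \<le> \<delta>" "\<delta> \<le> 1"
  shows "\<bar>count V H l - expected V H\<bar> \<le> (2 ^ card H - 1) * \<delta> * expected V H"
  using assms(1-4)
proof (induction "card H" arbitrary: V H rule: less_induct)
  case less
  note V = \<open>finite V\<close> and HV = \<open>H \<subseteq> pairs V\<close>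
  have finH: "finite H" using less.prems finite_pairs finite_subset by blast
  show ?case
  proof (cases "H = {}")
    case True
    then show ?thesis using V by (simp add: count_no_edges expected_def)
  next
    case False
    then obtain u v where e: "(u, v) \<in> H" by auto
    then have uv: "u \<in> V" "v \<in> V" using HV by (auto simp: pairs_def)
    define k where "k = card (H - {(u, v)})"
    have cH: "card H = Suc k" using card_Suc_Diff1[OF finH e] by (simp add: k_def)
    define n where "n = card V"
    have n: "n \<ge> 1" using V uv by (auto simp: n_def Suc_le_eq card_gt_0_iff)
    \<comment> \<open>\<open>A\<close> bounds the counts without \<open>u\<close> or \<open>v\<close>: removing a vertex loses the factor \<open>m\<close> and
      at most \<open>n - 1\<close> equations, hence gains at most \<open>q ^ (n - 1)\<close>; the factor \<open>2 ^ k\<close> absorbs the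
      relative error of the induction hypothesis.\<close>
    define A where "A = 2 ^ k * (m ^ (n - 1) * q ^ (n - 1) / q ^ Suc k)"
    have A: "A \<ge> 0" by (simp add: A_def)
    have vertex_removed: "count (V - {w}) (edges_off w H) l \<le> A"
      if w: "w \<in> V" "edges_at w H \<noteq> {}" for w
    proof -
      let ?H = "edges_off w H"
      have fin: "finite (edges_at w H)" "finite ?H"
        using finH edges_at_un_off(1)[of w H] by (metis finite_Un)+
      have cs: "card H = card (edges_at w H) + card ?H"
        using fin edges_at_un_off[of w H] by (metis card_Un_disjoint)
      have "card (edges_at w H) \<noteq> 0" using w fin by simp
      then have lt: "card ?H < card H" "card ?H \<le> k" using cs cH by auto
      have deg: "Suc k \<le> card ?H + (n - 1)"
        using cs card_edges_at_le[OF V HV w(1)] cH by (simp add: n_def)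
      have "\<bar>count (V - {w}) ?H l - expected (V - {w}) ?H\<bar>
          \<le> (2 ^ card ?H - 1) * \<delta> * expected (V - {w}) ?H"
        using less.prems lt(1) edges_off_pairs[OF HV] card_Diff1_le[of V w]
        by (intro less.hyps) (auto simp: edges_off_def)
      also have "\<dots> \<le> (2 ^ card ?H - 1) * 1 * expected (V - {w}) ?H"
        using \<delta> by (intro mult_right_mono mult_left_mono expected_nonneg) auto
      finally have "count (V - {w}) ?H l \<le> 2 ^ card ?H * expected (V - {w}) ?H"
        by (simp add: algebra_simps)
      also have "\<dots> \<le> 2 ^ k * (m ^ (n - 1) * q ^ (n - 1) / q ^ Suc k)"
      proof (intro mult_mono)
        have "q ^ Suc k \<le> q ^ (card ?H + (n - 1))"
          using deg q_ge_1 by (intro power_increasing)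
        then have "1 / q ^ card ?H \<le> q ^ (n - 1) / q ^ Suc k"
          using q_ge_1 by (simp add: field_simps power_add del: power_Suc)
        then have "m ^ (n - 1) * (1 / q ^ card ?H) \<le> m ^ (n - 1) * (q ^ (n - 1) / q ^ Suc k)"
          by (intro mult_left_mono) auto
        then show "expected (V - {w}) ?H \<le> m ^ (n - 1) * q ^ (n - 1) / q ^ Suc k"
          using w V by (simp add: expected_def n_def)
      qed (use lt in \<open>simp_all add: expected_nonneg\<close>)
      finally show ?thesis by (simp add: A_def)
    qed
    have ends: "edges_at u H \<noteq> {}" "edges_at v H \<noteq> {}"
      using e by (auto simp: edges_at_def)
    have "count (V - {u}) (edges_off u H) l * count (V - {v}) (edges_off v H) l \<le> A\<^sup>2"
      unfolding power2_eq_square using A uv ends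
      by (intro mult_mono vertex_removed) (auto simp: count_def)
    then have "sqrt (count (V - {u}) (edges_off u H) l * count (V - {v}) (edges_off v H) l) \<le> A"
      using A by (simp add: real_le_lsqrt)
    then have "sqrt K * sqrt (count (V - {u}) (edges_off u H) l * count (V - {v}) (edges_off v H) l)
        \<le> sqrt K * A"
      using K_nonneg by (intro mult_left_mono) auto
    with count_remove_edge[OF V HV e, of l] less.prems(4)[OF e] have edge:
      "\<bar>count V H l - count V (H - {(u, v)}) l / q\<bar> \<le> sqrt K * A"
      by linarith
    have "sqrt K * A = 2 ^ k * (m ^ (n - 1) / q ^ Suc k) * (sqrt K * q ^ (n - 1))"
      by (simp add: A_def)
    also have "\<dots> \<le> 2 ^ k * (m ^ (n - 1) / q ^ Suc k) * (\<delta> * m)"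
    proof (intro mult_left_mono)
      have "sqrt K * q ^ (n - 1) \<le> sqrt K * q ^ (t - 1)"
        using q_ge_1 less.prems(3) K_nonneg
        by (intro mult_left_mono power_increasing) (auto simp: n_def)
      then show "sqrt K * q ^ (n - 1) \<le> \<delta> * m" using \<delta>(1) by linarith
    qed simp
    also have "\<dots> = 2 ^ k * \<delta> * expected V H"
      using n by (simp add: expected_def cH n_def power_eq_if)
    finally have err: "sqrt K * A \<le> 2 ^ k * \<delta> * expected V H" .
    have "\<bar>count V (H - {(u, v)}) l - expected V (H - {(u, v)})\<bar>
        \<le> (2 ^ k - 1) * \<delta> * expected V (H - {(u, v)})"
      unfolding k_def using less.prems cH by (intro less.hyps) (auto simp: k_def)
    moreover have "expected V (H - {(u, v)}) = q * expected V H"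
      using q_ge_1 by (simp add: expected_def cH flip: k_def)
    ultimately have "\<bar>count V (H - {(u, v)}) l - q * expected V H\<bar>
        \<le> q * ((2 ^ k - 1) * \<delta> * expected V H)"
      by (simp add: mult_ac)
    then have "\<bar>count V (H - {(u, v)}) l / q - expected V H\<bar> \<le> (2 ^ k - 1) * \<delta> * expected V H"
      using q_ge_1 by (simp add: abs_le_iff field_simps)
    then have "\<bar>count V H l - expected V H\<bar>
        \<le> 2 ^ k * \<delta> * expected V H + (2 ^ k - 1) * \<delta> * expected V H"
      using edge err by linarith
    also have "\<dots> = (2 ^ card H - 1) * \<delta> * expected V H"
      by (simp add: cH algebra_simps)
    finally show ?thesis .
  qed
qed

section \<open>Average discrepancy over all prescribed labels\<close>

definition discrepancy :: "'v set \<Rightarrow> ('v \<times> 'v) set \<Rightarrow> real" where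
  "discrepancy V H = (\<Sum>l\<in>H \<rightarrow>\<^sub>E C. \<bar>count V H l - expected V H\<bar>)"

text \<open>A tuple of points determines the labels of its edges.\<close>

lemma sum_sat_le_1:
  assumes "finite H"
  shows "(\<Sum>l\<in>H \<rightarrow>\<^sub>E C. of_bool (sat H x l) :: real) \<le> 1"
proof -
  have "(\<Sum>l\<in>H \<rightarrow>\<^sub>E C. of_bool (sat H x l) :: real)
      = real (card ((H \<rightarrow>\<^sub>E C) \<inter> {l. sat H x l}))"
    using assms finite_C by (simp add: finite_PiE)
  also have "card ((H \<rightarrow>\<^sub>E C) \<inter> {l. sat H x l}) \<le> card {\<lambda>e\<in>H. lab (x (fst e)) (x (snd e))}"
  proof (intro card_mono subsetI)
    fix l assume l: "l \<in> (H \<rightarrow>\<^sub>E C) \<inter> {l. sat H x l}"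
    then have "l = (\<lambda>e\<in>H. lab (x (fst e)) (x (snd e)))"
      by (intro extensionalityI[of l H]) (auto simp: sat_def PiE_def)
    then show "l \<in> {\<lambda>e\<in>H. lab (x (fst e)) (x (snd e))}" by simp
  qed simp
  finally show ?thesis by simp
qed

text \<open>
  The new edge \<open>(u, v)\<close> contributes the deviation \<open>g\<close> of the degree of \<open>x\<^sub>u\<close> into the class
  \<open>T z l\<close> of those points for \<open>v\<close> that respect the labels of the old edges at \<open>v\<close>. These
  deviations are added up over the points \<open>z\<close> at the vertices other than \<open>v\<close>, over the labels of
  the old edges at \<open>v\<close>, and over the new label: the labels away from \<open>v\<close> are determined by \<open>z\<close>.
  Cauchy-Schwarz replaces \<open>g\<close> by its square, whose sum over \<open>x\<^sub>u\<close> is at most \<open>K\<close> times the size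
  of the class. For fixed \<open>z\<close> the classes are disjoint subsets of \<open>E\<close>, so their sizes add up to at
  most \<open>m\<close>. With \<open>n = |V|\<close> vertices, the number of summands is \<open>m ^ (n - 1)\<close> times a power of
  \<open>q\<close> whose exponent is bounded by the degree of \<open>v\<close>.
\<close>

lemma discrepancy_insert:
  fixes V :: "'v::linorder set"
  assumes V: "finite V" and H: "insert (u, v) H \<subseteq> pairs V" and new: "(u, v) \<notin> H"
  shows "discrepancy V (insert (u, v) H)
    \<le> discrepancy V H + m ^ (card V - 1) * sqrt (K * q ^ card V)"
proof -
  define e where "e = (u, v)"
  have uv: "u \<in> V" "v \<in> V" "u < v" and H': "H \<subseteq> pairs V" using H by (auto simp: pairs_def)
  have fH: "finite H" using H' V finite_pairs finite_subset by blast
  define H0 H1 where "H0 = edges_off v H" and "H1 = edges_at v H"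
  have Hs: "H = H1 \<union> H0" "H1 \<inter> H0 = {}"
    using edges_at_un_off[of v H] by (auto simp: H0_def H1_def)
  have fH01: "finite H0" "finite H1" using Hs fH by (metis finite_Un)+
  have off: "fst a \<noteq> v \<and> snd a \<noteq> v" if "a \<in> H0" for a
    using that by (auto simp: H0_def edges_off_def)
  have at: "fst a \<noteq> u \<and> snd a \<noteq> u" if a: "a \<in> H1" for a
  proof -
    have "a \<noteq> (u, v)" "a \<in> pairs V" "fst a = v \<or> snd a = v"
      using a new H' by (auto simp: H1_def edges_at_def)
    then show ?thesis using uv by (cases a) (auto simp: pairs_def)
  qed
  define W where "W = V - {u, v}"
  have W: "finite W" "u \<notin> W" "v \<notin> insert u W" "V = insert v (insert u W)"
    using uv V by (auto simp: W_def)
  define n where "n = card V"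
  have n: "n = card W + 2" using W by (simp add: n_def)
  have degree: "card H1 + 2 \<le> n"
  proof -
    have "edges_at v (insert e H) = insert e H1" by (auto simp: e_def H1_def edges_at_def)
    moreover have "e \<notin> H1" using new by (auto simp: e_def H1_def edges_at_def)
    ultimately have "card (edges_at v (insert e H)) = card H1 + 1" using fH01 by simp
    then show ?thesis
      using card_edges_at_le[OF V, of "insert e H" v] H uv n by (simp add: e_def n_def)
  qed
  define T where "T z l = {y \<in> E. sat H1 (z(v := y)) l}" for z l
  define g where "g z l c = real (card {y \<in> T z l. lab (z u) y = c}) - card (T z l) / q" for z l c
  have T: "T z l \<subseteq> E" "finite (T z l)" for z l using finite_E by (auto simp: T_def)
  let ?Z = "insert u W \<rightarrow>\<^sub>E E"
  have sat0: "sat H0 (z(v := y)) l = sat H0 z l" for z y l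
    using off by (intro sat_cong) auto
  have cnt: "count V H l = (\<Sum>z\<in>?Z. of_bool (sat H0 z l) * real (card (T z l)))" for l
  proof -
    have "count V H l = (\<Sum>z\<in>?Z. \<Sum>y\<in>E. of_bool (sat H (z(v := y)) l))"
      using V W(3) by (subst W(4)) (simp add: count_eq_sum sum_PiE_insert W(1))
    also have "\<dots> = (\<Sum>z\<in>?Z. of_bool (sat H0 z l) * (\<Sum>y\<in>E. of_bool (sat H1 (z(v := y)) l)))"
      by (intro sum.cong refl) (simp add: Hs(1) sat_Un sat0 of_bool_conj mult_ac sum_distrib_left
          del: sum_of_bool_eq sum_of_bool_mult_eq sum_mult_of_bool_eq)
    finally show ?thesis using finite_E by (simp add: T_def Int_def)
  qed
  have cnt': "count V (insert e H) (l(e := c))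
      = (\<Sum>z\<in>?Z. of_bool (sat H0 z l) * real (card {y \<in> T z l. lab (z u) y = c}))" for l c
  proof -
    have sat': "sat (insert e H) (z(v := y)) (l(e := c))
        \<longleftrightarrow> sat H0 z l \<and> (sat H1 (z(v := y)) l \<and> lab (z u) y = c)" for z y
    proof -
      have "sat H (z(v := y)) (l(e := c)) = sat H (z(v := y)) l"
        using new by (intro sat_cong) (auto simp: e_def)
      then show ?thesis using uv by (auto simp: sat_insert Hs(1) sat_Un sat0 e_def)
    qed
    have "count V (insert e H) (l(e := c))
        = (\<Sum>z\<in>?Z. \<Sum>y\<in>E. of_bool (sat (insert e H) (z(v := y)) (l(e := c))))"
      using V W(3) by (subst W(4)) (simp add: count_eq_sum sum_PiE_insert W(1))
    also have "\<dots> = (\<Sum>z\<in>?Z. of_bool (sat H0 z l)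
        * (\<Sum>y\<in>E. of_bool (sat H1 (z(v := y)) l \<and> lab (z u) y = c)))"
      unfolding sat'
      by (intro sum.cong refl) (simp only: of_bool_conj sum_distrib_left)
    finally show ?thesis using finite_E by (simp add: T_def Int_def conj_assoc)
  qed
  have step: "\<bar>count V (insert e H) (l(e := c)) - count V H l / q\<bar>
      \<le> (\<Sum>z\<in>?Z. of_bool (sat H0 z l) * \<bar>g z l c\<bar>)" for l c
  proof -
    have "count V (insert e H) (l(e := c)) - count V H l / q
        = (\<Sum>z\<in>?Z. of_bool (sat H0 z l) * g z l c)"
      unfolding cnt cnt' by (simp add: g_def right_diff_distrib sum_subtractf sum_divide_distrib)
    also have "\<bar>\<dots>\<bar> \<le> (\<Sum>z\<in>?Z. \<bar>of_bool (sat H0 z l) * g z l c\<bar>)"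
      by (rule sum_abs)
    finally show ?thesis by (simp add: abs_mult)
  qed
  have main: "(\<Sum>l\<in>H \<rightarrow>\<^sub>E C. \<Sum>c\<in>C. \<bar>count V (insert e H) (l(e := c)) - count V H l / q\<bar>)
      \<le> m ^ (n - 1) * sqrt (K * q ^ n)"
  proof -
    \<comment> \<open>A label vector is glued from its parts at \<open>v\<close> and off \<open>v\<close>. The deviations depend only on the
      first part, and for given \<open>z\<close> at most one second part is compatible with \<open>z\<close>.\<close>
    let ?comb = "\<lambda>l1 l0 i. if i \<in> H1 then l1 i else l0 i"
    have satc: "sat H0 z (?comb l1 l0) = sat H0 z l0" for z l1 l0
      using Hs(2) by (intro sat_cong) auto
    have Tc: "T z (?comb l1 l0) = T z l1" for z l1 l0
      unfolding T_def by (intro Collect_cong conj_cong refl sat_cong) auto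
    have gc: "g z (?comb l1 l0) c = g z l1 c" for z l1 l0 c
      by (simp add: g_def Tc)
    have "(\<Sum>l\<in>H \<rightarrow>\<^sub>E C. \<Sum>c\<in>C. \<bar>count V (insert e H) (l(e := c)) - count V H l / q\<bar>)
        \<le> (\<Sum>l\<in>H \<rightarrow>\<^sub>E C. \<Sum>c\<in>C. \<Sum>z\<in>?Z. of_bool (sat H0 z l) * \<bar>g z l c\<bar>)"
      by (intro sum_mono step)
    also have "\<dots> = (\<Sum>l1\<in>H1 \<rightarrow>\<^sub>E C. \<Sum>l0\<in>H0 \<rightarrow>\<^sub>E C. \<Sum>c\<in>C. \<Sum>z\<in>?Z.
        of_bool (sat H0 z l0) * \<bar>g z l1 c\<bar>)"
      by (subst Hs(1), subst sum_PiE_Un[OF Hs(2)]) (simp only: satc gc)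
    also have "\<dots> = (\<Sum>l1\<in>H1 \<rightarrow>\<^sub>E C. \<Sum>c\<in>C. \<Sum>z\<in>?Z.
        (\<Sum>l0\<in>H0 \<rightarrow>\<^sub>E C. of_bool (sat H0 z l0)) * \<bar>g z l1 c\<bar>)"
    proof (intro sum.cong refl)
      fix l1
      have "(\<Sum>l0\<in>H0 \<rightarrow>\<^sub>E C. \<Sum>c\<in>C. \<Sum>z\<in>?Z. of_bool (sat H0 z l0) * \<bar>g z l1 c\<bar>)
          = (\<Sum>c\<in>C. \<Sum>l0\<in>H0 \<rightarrow>\<^sub>E C. \<Sum>z\<in>?Z. of_bool (sat H0 z l0) * \<bar>g z l1 c\<bar>)"
        by (rule sum.swap)
      also have "\<dots> = (\<Sum>c\<in>C. \<Sum>z\<in>?Z. \<Sum>l0\<in>H0 \<rightarrow>\<^sub>E C. of_bool (sat H0 z l0) * \<bar>g z l1 c\<bar>)"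
        by (intro sum.cong refl sum.swap)
      finally show "(\<Sum>l0\<in>H0 \<rightarrow>\<^sub>E C. \<Sum>c\<in>C. \<Sum>z\<in>?Z. of_bool (sat H0 z l0) * \<bar>g z l1 c\<bar>)
          = (\<Sum>c\<in>C. \<Sum>z\<in>?Z. (\<Sum>l0\<in>H0 \<rightarrow>\<^sub>E C. of_bool (sat H0 z l0)) * \<bar>g z l1 c\<bar>)"
        by (simp only: sum_distrib_right)
    qed
    also have "\<dots> \<le> (\<Sum>l1\<in>H1 \<rightarrow>\<^sub>E C. \<Sum>c\<in>C. \<Sum>z\<in>?Z. 1 * \<bar>g z l1 c\<bar>)"
      by (intro sum_mono mult_right_mono sum_sat_le_1 fH01) simp
    also have "\<dots> = (\<Sum>p\<in>(H1 \<rightarrow>\<^sub>E C) \<times> C \<times> ?Z. \<bar>1 * g (snd (snd p)) (fst p) (fst (snd p))\<bar>)"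
      by (simp add: sum.cartesian_product case_prod_unfold)
    also have "\<dots> \<le> sqrt ((q ^ card H1 * (q * m ^ (n - 1))) * (m ^ (n - 1) * (q * K)))"
    proof (rule Cauchy_Schwarz_sum_abs)
      show "(\<Sum>p\<in>(H1 \<rightarrow>\<^sub>E C) \<times> C \<times> ?Z. (1::real)\<^sup>2) \<le> q ^ card H1 * (q * m ^ (n - 1))"
        using W n fH01 by (simp add: card_cartesian_product card_PiE)
      \<comment> \<open>No old edge joins \<open>u\<close> and \<open>v\<close>, so the class is fixed while \<open>x\<^sub>u\<close> runs through \<open>E\<close>.\<close>
      have Tz: "T (z(u := x)) l = T z l" for z x l
      proof -
        have "sat H1 (z(u := x, v := y)) l = sat H1 (z(v := y)) l" for y
          using at by (intro sat_cong) auto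
        then show ?thesis by (simp add: T_def)
      qed
      have sumT: "(\<Sum>l\<in>H1 \<rightarrow>\<^sub>E C. real (card (T z l))) \<le> m" for z
      proof -
        have "(\<Sum>l\<in>H1 \<rightarrow>\<^sub>E C. real (card (T z l)))
            = (\<Sum>l\<in>H1 \<rightarrow>\<^sub>E C. \<Sum>y\<in>E. of_bool (sat H1 (z(v := y)) l))"
          using finite_E by (simp add: T_def Int_def)
        also have "\<dots> = (\<Sum>y\<in>E. \<Sum>l\<in>H1 \<rightarrow>\<^sub>E C. of_bool (sat H1 (z(v := y)) l))"
          by (rule sum.swap)
        also have "\<dots> \<le> (\<Sum>y\<in>E. 1)" by (intro sum_mono sum_sat_le_1 fH01)
        finally show ?thesis by simp
      qed
      have "(\<Sum>p\<in>(H1 \<rightarrow>\<^sub>E C) \<times> C \<times> ?Z. (g (snd (snd p)) (fst p) (fst (snd p)))\<^sup>2)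
          = (\<Sum>l\<in>H1 \<rightarrow>\<^sub>E C. \<Sum>c\<in>C. \<Sum>z\<in>?Z. (g z l c)\<^sup>2)"
        by (simp add: sum.cartesian_product case_prod_unfold)
      also have "\<dots> = (\<Sum>l\<in>H1 \<rightarrow>\<^sub>E C. \<Sum>c\<in>C. \<Sum>z\<in>W \<rightarrow>\<^sub>E E. \<Sum>x\<in>E. (g (z(u := x)) l c)\<^sup>2)"
        using W by (simp add: sum_PiE_insert)
      also have "\<dots> \<le> (\<Sum>l\<in>H1 \<rightarrow>\<^sub>E C. \<Sum>c\<in>C. \<Sum>z\<in>W \<rightarrow>\<^sub>E E. K * card (T z l))"
        using degree_variance[OF T(1)] by (intro sum_mono) (simp add: g_def Tz)
      also have "\<dots> = (\<Sum>z\<in>W \<rightarrow>\<^sub>E E. q * K * (\<Sum>l\<in>H1 \<rightarrow>\<^sub>E C. real (card (T z l))))"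
      proof -
        have "(\<Sum>l\<in>H1 \<rightarrow>\<^sub>E C. \<Sum>c\<in>C. \<Sum>z\<in>W \<rightarrow>\<^sub>E E. K * card (T z l))
            = (\<Sum>l\<in>H1 \<rightarrow>\<^sub>E C. \<Sum>z\<in>W \<rightarrow>\<^sub>E E. q * K * card (T z l))"
          by (simp add: sum_distrib_left mult_ac)
        also have "\<dots> = (\<Sum>z\<in>W \<rightarrow>\<^sub>E E. \<Sum>l\<in>H1 \<rightarrow>\<^sub>E C. q * K * card (T z l))"
          by (rule sum.swap)
        finally show ?thesis by (simp only: sum_distrib_left)
      qed
      also have "\<dots> \<le> (\<Sum>z\<in>W \<rightarrow>\<^sub>E E. q * K * m)"
        using K_nonneg by (intro sum_mono mult_left_mono sumT) auto
      also have "\<dots> = m ^ (n - 1) * (q * K)"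
        using W n by (simp add: card_PiE)
      finally show "(\<Sum>p\<in>(H1 \<rightarrow>\<^sub>E C) \<times> C \<times> ?Z. (g (snd (snd p)) (fst p) (fst (snd p)))\<^sup>2)
          \<le> m ^ (n - 1) * (q * K)" .
    qed
    also have "\<dots> = sqrt ((m ^ (n - 1))\<^sup>2 * (K * q ^ (card H1 + 2)))"
      by (simp add: power2_eq_square power_add mult_ac)
    also have "\<dots> = m ^ (n - 1) * sqrt (K * q ^ (card H1 + 2))"
      by (simp add: real_sqrt_mult)
    also have "\<dots> \<le> m ^ (n - 1) * sqrt (K * q ^ n)"
      using q_ge_1 degree K_nonneg
      by (intro mult_left_mono real_sqrt_le_mono power_increasing) auto
    finally show ?thesis .
  qed
  have eH: "expected V (insert e H) = expected V H / q"
    using new fH by (simp add: expected_def e_def)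
  have "discrepancy V (insert e H)
      = (\<Sum>l\<in>H \<rightarrow>\<^sub>E C. \<Sum>c\<in>C. \<bar>count V (insert e H) (l(e := c)) - expected V H / q\<bar>)"
    using new unfolding discrepancy_def eH by (simp add: sum_PiE_insert e_def)
  also have "\<dots> \<le> (\<Sum>l\<in>H \<rightarrow>\<^sub>E C. \<Sum>c\<in>C.
      \<bar>count V (insert e H) (l(e := c)) - count V H l / q\<bar> + \<bar>count V H l - expected V H\<bar> / q)"
  proof (intro sum_mono)
    fix l c
    have "\<bar>count V H l / q - expected V H / q\<bar> = \<bar>count V H l - expected V H\<bar> / q"
      using q_ge_1 by (simp flip: diff_divide_distrib)
    then show "\<bar>count V (insert e H) (l(e := c)) - expected V H / q\<bar>
      \<le> \<bar>count V (insert e H) (l(e := c)) - count V H l / q\<bar> + \<bar>count V H l - expected V H\<bar> / q"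
      by linarith
  qed
  also have "\<dots> = (\<Sum>l\<in>H \<rightarrow>\<^sub>E C. \<Sum>c\<in>C. \<bar>count V (insert e H) (l(e := c)) - count V H l / q\<bar>)
      + discrepancy V H"
    using q_ge_1 by (simp add: sum.distrib discrepancy_def)
  also have "\<dots> \<le> m ^ (n - 1) * sqrt (K * q ^ n) + discrepancy V H"
    using main by simp
  finally show ?thesis by (simp add: e_def n_def)
qed

lemma discrepancy_le:
  fixes V :: "'v::linorder set"
  assumes V: "finite V" and H: "H \<subseteq> pairs V"
  shows "discrepancy V H \<le> card H * (m ^ (card V - 1) * sqrt (K * q ^ card V))"
proof -
  have "finite H" using V H finite_pairs finite_subset by blast
  then show ?thesis using H
  proof (induction H)
    case empty
    then show ?case using V by (simp add: discrepancy_def count_no_edges expected_def)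
  next
    case (insert e H)
    have "discrepancy V (insert (fst e, snd e) H)
        \<le> discrepancy V H + m ^ (card V - 1) * sqrt (K * q ^ card V)"
      using insert by (intro discrepancy_insert V) auto
    then show ?case using insert by (simp add: algebra_simps)
  qed
qed

text \<open>Each unsolvable vector of labels contributes the whole of \<open>expected V H\<close> to the discrepancy.\<close>

lemma card_unsolvable_le:
  fixes V :: "'v::linorder set"
  assumes V: "finite V" "V \<noteq> {}" and H: "H \<subseteq> pairs V" and m: "m > 0"
  shows "real (card {l \<in> H \<rightarrow>\<^sub>E C. count V H l = 0})
    \<le> card H * (sqrt (K * q ^ card V) / m) * q ^ card H"
proof -
  let ?U = "{l \<in> H \<rightarrow>\<^sub>E C. count V H l = 0}"
  have fin: "finite (H \<rightarrow>\<^sub>E C)"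
    using V H finite_pairs finite_subset finite_C by (metis finite_PiE)
  have "real (card ?U) * expected V H = (\<Sum>l\<in>?U. \<bar>count V H l - expected V H\<bar>)"
    using expected_nonneg[of V H] by simp
  also have "\<dots> \<le> discrepancy V H"
    unfolding discrepancy_def using fin by (intro sum_mono2) auto
  also have "\<dots> \<le> card H * (m ^ (card V - 1) * sqrt (K * q ^ card V))"
    by (rule discrepancy_le[OF V(1) H])
  also have "\<dots> = card H * (sqrt (K * q ^ card V) / m) * q ^ card H * expected V H"
  proof -
    have "card V \<noteq> 0" using V by simp
    then have "m ^ card V = m * m ^ (card V - 1)" by (simp add: power_eq_if)
    then show ?thesis using m q_ge_1 by (simp add: expected_def)
  qed
  finally show ?thesis
    by (rule mult_right_le_imp_le) (use m q_ge_1 in \<open>simp add: expected_def\<close>)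
qed

end

section \<open>The labelling defined by a bilinear form\<close>

text \<open>
  The linear functional \<open>b \<mapsto> B b u\<close> is nonzero, hence onto, and translations by a vector \<open>w\<close>
  with \<open>B w u = c\<close> show that all its fibres have the same size.
\<close>

lemma nondegenerate_fibre_card:
  fixes R (structure)
  assumes "field R" and "module R M" and fin: "finite (carrier R)" "finite (carrier M)"
    and bil: "bilinear_form R M B" and nd: "nondegenerate R M B"
    and u: "u \<in> carrier M" "u \<noteq> \<zero>\<^bsub>M\<^esub>" and c: "c \<in> carrier R"
  shows "real (card {b \<in> carrier M. B b u = c}) = card (carrier M) / card (carrier R)"
proof -
  interpret field R by fact
  interpret module R M by fact
  have ab: "abelian_group R" and am: "abelian_monoid R" by unfold_locales
  have B_closed: "B v w \<in> carrier R" if "v \<in> carrier M" "w \<in> carrier M" for v w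
    using bil that by (simp add: bilinear_form_def)
  have B_add: "B (v \<oplus>\<^bsub>M\<^esub> w) u = B v u \<oplus> B w u" if "v \<in> carrier M" "w \<in> carrier M" for v w
    using bil that u by (simp add: bilinear_form_def)
  have B_smult: "B (s \<odot>\<^bsub>M\<^esub> v) u = s \<otimes> B v u" if "s \<in> carrier R" "v \<in> carrier M" for s v
    using bil that u by (simp add: bilinear_form_def)
  obtain b0 where b0: "b0 \<in> carrier M" "B b0 u \<noteq> \<zero>"
    using nd u unfolding nondegenerate_def by blast
  have unit: "B b0 u \<in> Units R"
    using b0 u B_closed by (simp add: field_Units)
  have fibre: "card {b \<in> carrier M. B b u = c} = card {b \<in> carrier M. B b u = \<zero>}"
    if c: "c \<in> carrier R" for c
  proof -
    define w where "w = (c \<otimes> inv (B b0 u)) \<odot>\<^bsub>M\<^esub> b0"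
    have w: "w \<in> carrier M" using c unit b0 by (simp add: w_def)
    have Bw: "B w u = c"
      using c unit b0 u B_closed by (simp add: w_def B_smult m_assoc)
    have Bneg: "B (\<ominus>\<^bsub>M\<^esub> w) u = \<ominus> c"
    proof -
      have "B (w \<oplus>\<^bsub>M\<^esub> \<ominus>\<^bsub>M\<^esub> w) u = \<zero>"
        using B_smult[of \<zero> w] w u B_closed[of w u] by (simp add: M.r_neg)
      then have "c \<oplus> B (\<ominus>\<^bsub>M\<^esub> w) u = \<zero>"
        using B_add[of w "\<ominus>\<^bsub>M\<^esub> w"] w Bw by simp
      then have "B (\<ominus>\<^bsub>M\<^esub> w) u \<oplus> c = \<zero>"
        using c w u B_closed by (simp add: abelian_monoid.a_comm[OF am, of c])
      then have "\<ominus> c = B (\<ominus>\<^bsub>M\<^esub> w) u"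
        using c w u B_closed by (intro abelian_group.minus_equality[OF ab]) auto
      then show ?thesis by simp
    qed
    have "bij_betw (\<lambda>b. b \<oplus>\<^bsub>M\<^esub> w) {b \<in> carrier M. B b u = \<zero>} {b \<in> carrier M. B b u = c}"
      using w c
      by (intro bij_betw_byWitness[where f' = "\<lambda>b. b \<oplus>\<^bsub>M\<^esub> \<ominus>\<^bsub>M\<^esub> w"])
        (auto simp: B_add Bw Bneg M.a_assoc M.r_neg M.l_neg abelian_group.r_neg[OF ab])
    then show ?thesis by (simp add: bij_betw_same_card)
  qed
  have "real (card (carrier M)) = (\<Sum>c\<in>carrier R. real (card {b \<in> carrier M. B b u = c}))"
    using fin u B_closed by (subst sum_card_fibres) auto
  also have "\<dots> = (\<Sum>c'\<in>carrier R. real (card {b \<in> carrier M. B b u = c}))"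
    by (intro sum.cong refl arg_cong[of _ _ real]) (rule trans[OF fibre fibre[OF c, symmetric]])
  also have "\<dots> = card (carrier R) * real (card {b \<in> carrier M. B b u = c})"
    by simp
  finally show ?thesis
    using fin carrier_not_empty by (simp add: field_simps card_eq_0_iff)
qed

text \<open>
  Since the mean \<open>|S| / q\<close> is exact, the sum is the sum of the squared degrees minus
  \<open>|S|\<^sup>2 K / q\<close>. The squared degrees count pairs in \<open>S\<close> with a common neighbour: pairs of distinct
  points contribute at most that term, and the \<open>|S|\<close> diagonal pairs contribute \<open>K |S|\<close>.
\<close>

lemma sum_centred_degree_squares:
  fixes adj :: "'x \<Rightarrow> 'x \<Rightarrow> bool" and K q :: real
  assumes "finite V" "S \<subseteq> V" "q > 0"
    and cV: "real (card V) = q * K"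
    and deg: "\<And>y. y \<in> V \<Longrightarrow> real (card {x \<in> V. adj x y}) = K"
    and codeg: "\<And>y y'. y \<in> V \<Longrightarrow> y' \<in> V \<Longrightarrow> y \<noteq> y' \<Longrightarrow>
      real (card {x \<in> V. adj x y \<and> adj x y'}) \<le> K / q"
  shows "(\<Sum>x\<in>V. (real (card {y \<in> S. adj x y}) - card S / q)\<^sup>2) \<le> K * card S"
proof -
  have fS: "finite S" using assms finite_subset by blast
  define D where "D x = real (card {y \<in> S. adj x y})" for x
  have D: "D x = (\<Sum>y\<in>S. of_bool (adj x y))" for x
    using fS by (simp add: D_def sum_of_bool_eq Int_def conj_commute)
  have K: "K \<ge> 0" using cV \<open>q > 0\<close> by (metis of_nat_0_le_iff zero_le_mult_iff less_le_not_le)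
  have "(\<Sum>x\<in>V. D x) = (\<Sum>y\<in>S. \<Sum>x\<in>V. of_bool (adj x y))"
    unfolding D by (rule sum.swap)
  also have "\<dots> = (\<Sum>y\<in>S. K)"
  proof (rule sum.cong)
    fix y assume "y \<in> S"
    with assms(2) have "y \<in> V" by auto
    from deg[OF this] show "(\<Sum>x\<in>V. of_bool (adj x y)) = K"
      using \<open>finite V\<close> by (simp add: sum_of_bool_eq Int_def conj_commute)
  qed simp
  finally have S1: "(\<Sum>x\<in>V. D x) = K * card S" by simp
  have "(\<Sum>x\<in>V. (D x)\<^sup>2) = (\<Sum>x\<in>V. \<Sum>y\<in>S. \<Sum>y'\<in>S. of_bool (adj x y \<and> adj x y'))"
    unfolding D power2_eq_square sum_product by (simp add: of_bool_conj)
  also have "\<dots> = (\<Sum>y\<in>S. \<Sum>y'\<in>S. \<Sum>x\<in>V. of_bool (adj x y \<and> adj x y'))"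
    by (subst sum.swap) (intro sum.cong refl sum.swap)
  also have "\<dots> \<le> (\<Sum>y\<in>S. \<Sum>y'\<in>S. K / q + (if y = y' then K else 0))"
  proof (intro sum_mono)
    fix y y' assume "y \<in> S" "y' \<in> S"
    with assms(2) have *: "y \<in> V" "y' \<in> V" by auto
    then show "(\<Sum>x\<in>V. of_bool (adj x y \<and> adj x y')) \<le> K / q + (if y = y' then K else 0)"
      using deg[of y] codeg[of y y'] K \<open>q > 0\<close> \<open>finite V\<close>
      by (cases "y = y'") (simp_all add: sum_of_bool_eq Int_def conj_commute)
  qed
  also have "\<dots> = (card S)\<^sup>2 * (K / q) + K * card S"
    using fS by (simp add: sum.distrib power2_eq_square algebra_simps)
  finally have S2: "(\<Sum>x\<in>V. (D x)\<^sup>2) \<le> (card S)\<^sup>2 * (K / q) + K * card S" .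
  have "(\<Sum>x\<in>V. (D x - m)\<^sup>2) = (\<Sum>x\<in>V. (D x)\<^sup>2) - 2 * m * (\<Sum>x\<in>V. D x) + card V * m\<^sup>2" for m :: real
  proof -
    have "(D x - m)\<^sup>2 = (D x)\<^sup>2 - 2 * m * D x + m\<^sup>2" for x
      by (simp add: power2_diff)
    then show ?thesis by (simp add: sum.distrib sum_subtractf sum_distrib_left)
  qed
  then have "(\<Sum>x\<in>V. (D x - card S / q)\<^sup>2) \<le> (card S)\<^sup>2 * (K / q) + K * card S - 2 * (card S / q) * (K * card S)
      + q * K * (card S / q)\<^sup>2"
    using S2 S1 cV by simp
  also have "\<dots> = K * card S"
    using \<open>q > 0\<close> by (simp add: field_simps power2_eq_square)
  finally show ?thesis by (simp add: D_def)
qed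

definition label ::
  "('a, 'm) ring_scheme \<Rightarrow> ('v \<Rightarrow> 'v \<Rightarrow> 'a) \<Rightarrow> 'a \<times> 'v \<Rightarrow> 'a \<times> 'v \<Rightarrow> 'a" where
  "label R B x y = B (snd x) (snd y) \<ominus>\<^bsub>R\<^esub> (fst x \<oplus>\<^bsub>R\<^esub> fst y)"

lemma (in abelian_group) diff_sum_eq_iff:
  assumes "a \<in> carrier G" "a' \<in> carrier G" "b \<in> carrier G" "c \<in> carrier G"
  shows "b \<ominus> (a \<oplus> a') = c \<longleftrightarrow> a \<oplus> a' \<oplus> c = b"
proof
  assume "b \<ominus> (a \<oplus> a') = c"
  then have "a \<oplus> a' \<oplus> c = (a \<oplus> a') \<oplus> (b \<ominus> (a \<oplus> a'))" by simp
  also have "\<dots> = b"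
    using assms a_lcomm[of "a \<oplus> a'" b "\<ominus> (a \<oplus> a')"] by (simp add: minus_eq r_neg)
  finally show "a \<oplus> a' \<oplus> c = b" .
next
  assume "a \<oplus> a' \<oplus> c = b"
  then have "b \<ominus> (a \<oplus> a') = (a \<oplus> a' \<oplus> c) \<ominus> (a \<oplus> a')" by simp
  also have "\<dots> = c"
    using assms a_comm[of "a \<oplus> a'" c] a_assoc[of c "a \<oplus> a'" "\<ominus> (a \<oplus> a')"]
    by (simp add: minus_eq r_neg)
  finally show "b \<ominus> (a \<oplus> a') = c" .
qed

lemma (in abelian_group) diff_sum_eq_swap:
  assumes "a \<in> carrier G" "a' \<in> carrier G" "b \<in> carrier G" "c \<in> carrier G"
  shows "b \<ominus> (a \<oplus> a') = c \<longleftrightarrow> a = b \<ominus> (a' \<oplus> c)"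
proof -
  have "a \<oplus> a' \<oplus> c = a' \<oplus> c \<oplus> a" using assms by (simp add: a_ac)
  then show ?thesis
    using assms diff_sum_eq_iff[of a a' b c] diff_sum_eq_iff[of a' c b a] by auto
qed

lemma (in abelian_group) diff_eq_diff_iff:
  assumes "p \<in> carrier G" "s \<in> carrier G" "a \<in> carrier G" "a' \<in> carrier G" "c \<in> carrier G"
  shows "(p \<oplus> s) \<ominus> (a \<oplus> c) = s \<ominus> (a' \<oplus> c) \<longleftrightarrow> p = a \<ominus> a'"
proof -
  have 1: "(p \<oplus> s) \<ominus> (a \<oplus> c) = (p \<ominus> a) \<oplus> (s \<ominus> c)"
    using assms by (simp add: minus_eq minus_add a_ac)
  have 2: "s \<ominus> (a' \<oplus> c) = \<ominus> a' \<oplus> (s \<ominus> c)"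
    using assms by (simp add: minus_eq minus_add a_ac)
  have "(p \<ominus> a) \<oplus> (s \<ominus> c) = \<ominus> a' \<oplus> (s \<ominus> c) \<longleftrightarrow> p \<ominus> a = \<ominus> a'"
    using assms by simp
  also have "\<dots> \<longleftrightarrow> p = a \<ominus> a'"
  proof
    assume "p \<ominus> a = \<ominus> a'"
    then have "a \<oplus> (p \<ominus> a) = a \<ominus> a'" by (simp add: minus_eq)
    moreover have "a \<oplus> (p \<ominus> a) = p"
      using assms a_lcomm[of a p "\<ominus> a"] by (simp add: minus_eq r_neg)
    ultimately show "p = a \<ominus> a'" by simp
  next
    assume "p = a \<ominus> a'"
    then show "p \<ominus> a = \<ominus> a'"
      using assms by (simp add: minus_eq a_ac r_neg2)
  qed
  finally show ?thesis by (simp only: 1 2)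
qed

text \<open>
  A neighbour \<open>(a, b)\<close> of a given point is determined by \<open>b\<close>, which is arbitrary, so all degrees
  are \<open>|M|\<close>. Two distinct points \<open>(a, u)\<close> and \<open>(a', u')\<close> have a common neighbour over \<open>b\<close> exactly if
  \<open>B b (u - u') = a - a'\<close>. For \<open>u \<noteq> u'\<close> such \<open>b\<close> form one fibre of a nonzero functional; for
  \<open>u = u'\<close> there are none.
\<close>

lemma label_degree_variance:
  fixes R (structure)
  assumes "field R" and "module R M" and fin: "finite (carrier R)" "finite (carrier M)"
    and bil: "bilinear_form R M B" and nd: "nondegenerate R M B"
    and S: "S \<subseteq> carrier R \<times> carrier M" and c: "c \<in> carrier R"
  shows "(\<Sum>x\<in>carrier R \<times> carrier M.
      (real (card {y \<in> S. label R B x y = c}) - card S / card (carrier R))\<^sup>2)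
    \<le> real (card (carrier M)) * real (card S)"
proof -
  interpret field R by fact
  interpret module R M by fact
  have B_closed[simp]: "B v w \<in> carrier R" if "v \<in> carrier M" "w \<in> carrier M" for v w
    using bil that by (simp add: bilinear_form_def)
  have B_add: "B b (v \<oplus>\<^bsub>M\<^esub> w) = B b v \<oplus> B b w"
    if "b \<in> carrier M" "v \<in> carrier M" "w \<in> carrier M" for b v w
    using bil that by (simp add: bilinear_form_def)
  have ab: "abelian_group R" by unfold_locales
  have label_iff: "label R B (a, b) (a', b') = c \<longleftrightarrow> a = B b b' \<ominus> (a' \<oplus> c)"
    if "a \<in> carrier R" "a' \<in> carrier R" "b \<in> carrier M" "b' \<in> carrier M" for a b a' b'
    using abelian_group.diff_sum_eq_swap[OF ab that(1,2) _ c] that by (simp add: label_def)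
  let ?V = "carrier R \<times> carrier M"
  have graph: "card {x \<in> ?V. label R B x (a', b') = c \<and> Q (snd x)} = card {b \<in> carrier M. Q b}"
    if "a' \<in> carrier R" "b' \<in> carrier M" for a' b' Q
  proof -
    have "{x \<in> ?V. label R B x (a', b') = c \<and> Q (snd x)}
        = {x \<in> ?V. fst x = B (snd x) b' \<ominus> (a' \<oplus> c) \<and> Q (snd x)}"
      by (rule Collect_cong) (use that label_iff in \<open>simp add: mem_Times_iff split_paired_all cong: conj_cong\<close>)
    also have "bij_betw snd \<dots> {b \<in> carrier M. Q b}"
      using that c
      by (intro bij_betw_byWitness[where f' = "\<lambda>b. (B b b' \<ominus> (a' \<oplus> c), b)"]) auto
    finally show ?thesis by (rule bij_betw_same_card)
  qed
  show ?thesis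
  proof (rule sum_centred_degree_squares)
    show "finite ?V" using fin by simp
    show "real (card (carrier R)) > 0"
      using fin carrier_not_empty by (simp add: card_gt_0_iff)
    show "real (card ?V) = real (card (carrier R)) * real (card (carrier M))"
      by (simp add: card_cartesian_product)
    show "real (card {x \<in> ?V. label R B x y = c}) = real (card (carrier M))" if "y \<in> ?V" for y
      using graph[of "fst y" "snd y" "\<lambda>_. True"] that by auto
    fix y y' assume y: "y \<in> ?V" and y': "y' \<in> ?V" and "y \<noteq> y'"
    obtain a u a' u' where [simp]: "y = (a, u)" "y' = (a', u')" by fastforce
    have car: "a \<in> carrier R" "a' \<in> carrier R" "u \<in> carrier M" "u' \<in> carrier M"
      using y y' by auto
    have eq: "B b u \<ominus> (a \<oplus> c) = B b u' \<ominus> (a' \<oplus> c) \<longleftrightarrow> B b (u \<ominus>\<^bsub>M\<^esub> u') = a \<ominus> a'"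
      if b: "b \<in> carrier M" for b
    proof -
      have "B b u = B b ((u \<ominus>\<^bsub>M\<^esub> u') \<oplus>\<^bsub>M\<^esub> u')"
        using car by (simp add: M.minus_eq M.a_assoc M.l_neg)
      then have *: "B b u = B b (u \<ominus>\<^bsub>M\<^esub> u') \<oplus> B b u'"
        using car b by (simp add: B_add)
      have "B b (u \<ominus>\<^bsub>M\<^esub> u') \<in> carrier R" "B b u' \<in> carrier R"
        using car b by auto
      then show ?thesis
        unfolding * using car c by (intro abelian_group.diff_eq_diff_iff[OF ab]) auto
    qed
    have "{x \<in> ?V. label R B x y = c \<and> label R B x y' = c}
        = {x \<in> ?V. label R B x (a, u) = c \<and> B (snd x) (u \<ominus>\<^bsub>M\<^esub> u') = a \<ominus> a'}"
      by (rule Collect_cong)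
        (use car c in \<open>simp add: label_iff eq[symmetric] mem_Times_iff split_paired_all cong: conj_cong\<close>)
    then have card_eq: "card {x \<in> ?V. label R B x y = c \<and> label R B x y' = c}
        = card {b \<in> carrier M. B b (u \<ominus>\<^bsub>M\<^esub> u') = a \<ominus> a'}"
      using graph[OF car(1,3)] by simp
    show "real (card {x \<in> ?V. label R B x y = c \<and> label R B x y' = c})
        \<le> real (card (carrier M)) / real (card (carrier R))"
    proof (cases "u = u'")
      case True
      then have ne: "a \<noteq> a'" using \<open>y \<noteq> y'\<close> by simp
      have empty: "{b \<in> carrier M. B b (u \<ominus>\<^bsub>M\<^esub> u') = a \<ominus> a'} = {}"
      proof -
        have "\<not> B b (u \<ominus>\<^bsub>M\<^esub> u') = a \<ominus> a'" if "b \<in> carrier M" for b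
        proof
          assume "B b (u \<ominus>\<^bsub>M\<^esub> u') = a \<ominus> a'"
          then have same: "B b u \<ominus> (a \<oplus> c) = B b u \<ominus> (a' \<oplus> c)"
            using eq[OF that] True by simp
          have p: "B b u \<in> carrier R" using that car by simp
          have r: "B b u \<ominus> (a \<oplus> c) \<in> carrier R"
            using p car c by simp
          have "a = B b u \<ominus> (c \<oplus> (B b u \<ominus> (a \<oplus> c)))"
            using abelian_group.diff_sum_eq_swap[OF ab car(1) c p r] by simp
          moreover have "a' = B b u \<ominus> (c \<oplus> (B b u \<ominus> (a \<oplus> c)))"
            using abelian_group.diff_sum_eq_swap[OF ab car(2) c p r] same by simp
          ultimately show False using ne by simp
        qed
        then show ?thesis by auto
      qed
      show ?thesis unfolding card_eq empty by simp
    next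
      case False
      have "(u \<ominus>\<^bsub>M\<^esub> u') \<oplus>\<^bsub>M\<^esub> u' = u"
        using car by (simp add: M.minus_eq M.a_assoc M.l_neg)
      then have ne: "u \<ominus>\<^bsub>M\<^esub> u' \<noteq> \<zero>\<^bsub>M\<^esub>" using False car by auto
      have "u \<ominus>\<^bsub>M\<^esub> u' \<in> carrier M" "a \<ominus> a' \<in> carrier R" using car by auto
      from nondegenerate_fibre_card[OF assms(1-6) this(1) ne this(2)]
      show ?thesis unfolding card_eq by simp
    qed
  qed (use S in auto)
qed

section \<open>Counting solutions of the system\<close>

lemma label_uniform_labelling:
  assumes "field F" "finite (carrier F)"
    and E: "E \<subseteq> carrier F \<times> carrier (coord_space F d)"
    and B: "bilinear_form F (coord_space F d) B" "nondegenerate F (coord_space F d) B"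
  shows "uniform_labelling E (carrier F) (label F B) (real (order F ^ d))"
proof -
  interpret field F by fact
  have M: "module F (coord_space F d)" by (rule coord_space_module) unfold_locales
  have finM: "finite (carrier (coord_space F d))" and cardM: "card (carrier (coord_space F d)) = order F ^ d"
    using assms(2) by (auto simp: coord_space_def order_def card_PiE intro!: finite_PiE)
  have finX: "finite (carrier F \<times> carrier (coord_space F d))"
    using assms(2) finM by simp
  show ?thesis
  proof
    show "finite E" using E finX finite_subset by blast
    show "carrier F \<noteq> {}" by (rule carrier_not_empty)
    fix S c assume S: "S \<subseteq> E" and c: "c \<in> carrier F"
    let ?h = "\<lambda>x. (real (card {y \<in> S. label F B x y = c}) - card S / card (carrier F))\<^sup>2"
    have "(\<Sum>x\<in>E. ?h x) \<le> (\<Sum>x\<in>carrier F \<times> carrier (coord_space F d). ?h x)"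
      using E finX by (intro sum_mono2) auto
    also have "\<dots> \<le> real (card (carrier (coord_space F d))) * real (card S)"
      using assms M finM S c by (intro label_degree_variance) auto
    finally show "(\<Sum>x\<in>E. ?h x) \<le> real (order F ^ d) * real (card S)"
      by (simp add: cardM)
  qed (use assms(2) in auto)
qed

lemma solutions_eq_sat:
  assumes F: "field F"
    and E: "E \<subseteq> carrier F \<times> carrier (coord_space F d)"
    and B: "bilinear_form F (coord_space F d) B" and l: "l \<in> parameters F t"
  shows "solutions F t E B l
    = {x \<in> {1..t} \<rightarrow>\<^sub>E E. \<forall>e\<in>pairs {1..t}. label F B (x (fst e)) (x (snd e)) = l e}"
proof -
  interpret field F by fact
  have ab: "abelian_group F" by unfold_locales
  have "fst (x i) \<oplus>\<^bsub>F\<^esub> fst (x j) \<oplus>\<^bsub>F\<^esub> l (i, j) = B (snd (x i)) (snd (x j))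
      \<longleftrightarrow> label F B (x i) (x j) = l (i, j)"
    if x: "x \<in> {1..t} \<rightarrow>\<^sub>E E" and ij: "1 \<le> i" "i < j" "j \<le> t" for x i j
  proof -
    have "x i \<in> E" "x j \<in> E" using x ij by auto
    then have "fst (x i) \<in> carrier F" "fst (x j) \<in> carrier F"
      "snd (x i) \<in> carrier (coord_space F d)" "snd (x j) \<in> carrier (coord_space F d)"
      using E by auto
    moreover have "l (i, j) \<in> carrier F" using l ij by (auto simp: parameters_def)
    ultimately show ?thesis
      using B abelian_group.diff_sum_eq_iff[OF ab, of "fst (x i)" "fst (x j)" "B (snd (x i)) (snd (x j))" "l (i, j)"]
      by (simp add: label_def bilinear_form_def)
  qed
  then show ?thesis unfolding solutions_def pairs_def by fastforce
qed

lemma sqrt_power_mult_power: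
  assumes "x > (0::real)"
  shows "sqrt (x ^ d) * x ^ k = x powr (real d / 2 + real k)"
proof -
  have "sqrt (x ^ d) = x powr (real d / 2)"
    using assms by (simp add: powr_realpow[symmetric] powr_powr flip: powr_half_sqrt)
  then show ?thesis using assms by (simp add: powr_add powr_realpow)
qed

lemma card_solutions_close:
  assumes F: "field F" "finite (carrier F)"
    and E: "E \<subseteq> carrier F \<times> carrier (coord_space F d)" "card E > 0"
    and B: "bilinear_form F (coord_space F d) B" "nondegenerate F (coord_space F d) B"
    and t: "t \<ge> 1" and l: "l \<in> parameters F t"
    and \<delta>: "\<delta> = real (order F) powr (real d / 2 + real t - 1) / card E" "\<delta> \<le> 1"
  shows "\<bar>real (card (solutions F t E B l)) - real (card E) ^ t / real (order F) ^ (t choose 2)\<bar>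
    \<le> 2 ^ (t choose 2) * \<delta> * (real (card E) ^ t / real (order F) ^ (t choose 2))"
proof -
  interpret uniform_labelling E "carrier F" "label F B" "real (order F ^ d)"
    by (rule label_uniform_labelling) fact+
  have q: "real (order F) > 0" using q_ge_1 by (simp add: order_def)
  let ?H = "pairs {1..t}"
  have count: "count {1..t} ?H l = card (solutions F t E B l)"
    unfolding count_def sat_def by (simp only: solutions_eq_sat[OF F(1) E(1) B(1) l])
  have exp: "expected {1..t} ?H = real (card E) ^ t / real (order F) ^ (t choose 2)"
    by (simp add: expected_def card_pairs[unfolded One_nat_def] order_def)
  have "sqrt (real (order F ^ d)) * real (order F) ^ (t - 1) = \<delta> * card E"
    using sqrt_power_mult_power[OF q, of d "t - 1"] t E(2) by (simp add: \<delta>(1) of_nat_diff algebra_simps)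
  then have "\<bar>count {1..t} ?H l - expected {1..t} ?H\<bar> \<le> (2 ^ card ?H - 1) * \<delta> * expected {1..t} ?H"
    using l \<delta> by (intro count_close_to_expected[where t = t])
      (auto simp: order_def parameters_def pairs_def)
  also have "\<dots> \<le> 2 ^ card ?H * \<delta> * expected {1..t} ?H"
    using \<delta> by (intro mult_right_mono expected_nonneg) auto
  finally show ?thesis by (simp only: count exp card_pairs)
qed

lemma card_solvable_close:
  assumes F: "field F" "finite (carrier F)"
    and E: "E \<subseteq> carrier F \<times> carrier (coord_space F d)" "card E > 0"
    and B: "bilinear_form F (coord_space F d) B" "nondegenerate F (coord_space F d) B"
    and t: "t \<ge> 1"
  shows "\<bar>real (card {l \<in> parameters F t. solutions F t E B l \<noteq> {}}) - real (order F) ^ (t choose 2)\<bar>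
    \<le> real (t choose 2) * (real (order F) powr ((real d + real t) / 2) / card E)
      * real (order F) ^ (t choose 2)"
proof -
  interpret uniform_labelling E "carrier F" "label F B" "real (order F ^ d)"
    by (rule label_uniform_labelling) fact+
  have q: "real (order F) > 0" using q_ge_1 by (simp add: order_def)
  let ?H = "pairs {1..t}" let ?P = "parameters F t"
  let ?S = "{l \<in> ?P. solutions F t E B l \<noteq> {}}" and ?U = "{l \<in> ?P. solutions F t E B l = {}}"
  have P: "?P = ?H \<rightarrow>\<^sub>E carrier F"
  proof -
    have "{(i, j). 1 \<le> i \<and> i < j \<and> j \<le> t} = ?H" by (auto simp: pairs_def)
    then show ?thesis by (simp only: parameters_def)
  qed
  have fin: "finite ?P" unfolding P using F(2) by (intro finite_PiE finite_pairs) auto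
  have "card ?P = order F ^ (t choose 2)"
    unfolding P by (simp add: card_PiE finite_pairs card_pairs[unfolded One_nat_def] order_def)
  moreover have "card ?P = card ?S + card ?U"
  proof -
    have "?P = ?S \<union> ?U" by blast
    then have "card ?P = card (?S \<union> ?U)" by simp
    also have "\<dots> = card ?S + card ?U" using fin by (intro card_Un_disjoint) auto
    finally show ?thesis .
  qed
  ultimately have "real (order F ^ (t choose 2)) = real (card ?S + card ?U)"
    by (simp only:)
  then have split: "real (order F) ^ (t choose 2) = real (card ?S) + real (card ?U)"
    by (simp only: of_nat_add of_nat_power)
  have "?U = {l \<in> ?H \<rightarrow>\<^sub>E carrier F. count {1..t} ?H l = 0}"
  proof -
    have "solutions F t E B l = {} \<longleftrightarrow> count {1..t} ?H l = 0" if l: "l \<in> ?P" for l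
    proof -
      have "finite ({1..t} \<rightarrow>\<^sub>E E)" using finite_E by (intro finite_PiE) auto
      then have "finite (solutions F t E B l)" by (simp add: solutions_def)
      moreover have "count {1..t} ?H l = card (solutions F t E B l)"
        unfolding count_def sat_def by (simp only: solutions_eq_sat[OF F(1) E(1) B(1) l])
      ultimately show ?thesis by simp
    qed
    then show ?thesis unfolding P by blast
  qed
  moreover have "real (card {l \<in> ?H \<rightarrow>\<^sub>E carrier F. count {1..t} ?H l = 0})
      \<le> card ?H * (sqrt (real (order F ^ d) * real (card (carrier F)) ^ card {1..t}) / card E)
        * real (card (carrier F)) ^ card ?H"
    using t E by (intro card_unsolvable_le) auto
  ultimately have "real (card ?U) \<le> card ?H
      * (sqrt (real (order F ^ d) * real (card (carrier F)) ^ card {1..t}) / card E)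
      * real (card (carrier F)) ^ card ?H"
    by simp
  moreover have "sqrt (real (order F ^ d) * real (card (carrier F)) ^ card {1..t})
      = real (order F) powr ((real d + real t) / 2)"
    using sqrt_power_mult_power[OF q, of "d + t" 0] by (simp add: order_def power_add)
  ultimately have "real (card ?U) \<le> real (t choose 2)
      * (real (order F) powr ((real d + real t) / 2) / card E) * real (order F) ^ (t choose 2)"
    by (simp add: card_pairs[unfolded One_nat_def] order_def)
  then show ?thesis using split by simp
qed

section \<open>The limit of large fields\<close>

lemma asymp_equiv_of_relative_error:
  fixes f g \<epsilon> :: "nat \<Rightarrow> real"
  assumes bound: "eventually (\<lambda>n. \<bar>f n - g n\<bar> \<le> C * \<epsilon> n * g n) sequentially"
    and \<epsilon>: "\<epsilon> \<longlonglongrightarrow> 0" and g: "\<And>n. g n \<ge> 0"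
  shows "f \<sim>[sequentially] g"
  unfolding asymp_equiv_altdef
proof (rule landau_o.smallI)
  fix c :: real assume "c > 0"
  have "(\<lambda>n. C * \<epsilon> n) \<longlonglongrightarrow> C * 0" by (intro tendsto_intros \<epsilon>)
  then have "eventually (\<lambda>n. C * \<epsilon> n < c) sequentially"
    using \<open>c > 0\<close> by (intro order_tendstoD(2)[of _ "C * 0"]) auto
  with bound show "eventually (\<lambda>n. norm (f n - g n) \<le> c * norm (g n)) sequentially"
  proof eventually_elim
    case (elim n)
    have "C * \<epsilon> n * g n \<le> c * g n" using elim g by (intro mult_right_mono) auto
    then show ?case using elim g[of n] by simp
  qed
qed

lemma smallo_pos_imp_ratio:
  fixes h :: "nat \<Rightarrow> real" and k :: "nat \<Rightarrow> nat"
  assumes o: "h \<in> o(\<lambda>n. real (k n))" and pos: "\<And>n. h n > 0"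
  shows "(\<lambda>n. h n / real (k n)) \<longlonglongrightarrow> 0"
    and "eventually (\<lambda>n. k n > 0 \<and> h n / real (k n) \<le> 1) sequentially"
proof -
  show "(\<lambda>n. h n / real (k n)) \<longlonglongrightarrow> 0" using o by (rule smalloD_tendsto)
  have "eventually (\<lambda>n. norm (h n) \<le> 1 * norm (real (k n))) sequentially"
    using o by (rule landau_o.smallD) simp
  then show "eventually (\<lambda>n. k n > 0 \<and> h n / real (k n) \<le> 1) sequentially"
  proof eventually_elim
    case (elim n)
    then have "k n > 0" using pos[of n] by (cases "k n = 0") auto
    then show ?case using elim pos[of n] by simp
  qed
qed

theorem theorem2p22:
  fixes d t :: nat
    and F :: "nat \<Rightarrow> 'a ring"
    and E :: "nat \<Rightarrow> ('a \<times> (nat \<Rightarrow> 'a)) set"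
    and B :: "nat \<Rightarrow> (nat \<Rightarrow> 'a) \<Rightarrow> (nat \<Rightarrow> 'a) \<Rightarrow> 'a"
    and q :: "nat \<Rightarrow> nat"
  assumes "d \<ge> 1" and "t \<ge> 2"
    and "\<And>n. odd_finite_field (F n)"
    and "\<And>n. q n = order (F n)"
    and "filterlim q at_top sequentially"
    and "\<And>n. E n \<subseteq> carrier (F n) \<times> carrier (coord_space (F n) d)"
    and "\<And>n. bilinear_form (F n) (coord_space (F n) d) (B n)"
    and "\<And>n. nondegenerate (F n) (coord_space (F n) d) (B n)"
  shows
    "((\<lambda>n. real (q n) powr (real d / 2 + real t - 1)) \<in> o(\<lambda>n. real (card (E n))) \<longrightarrow>
        (\<forall>l. (\<forall>n. l n \<in> parameters (F n) t) \<longrightarrow>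
          (\<lambda>n. real (card (solutions (F n) t (E n) (B n) (l n))))
            \<sim>[sequentially] (\<lambda>n. real (card (E n)) ^ t / real (q n) ^ (t choose 2))))
     \<and>
     ((\<lambda>n. real (q n) powr ((real d + real t) / 2)) \<in> o(\<lambda>n. real (card (E n))) \<longrightarrow>
        (\<lambda>n. real (card {l \<in> parameters (F n) t. solutions (F n) t (E n) (B n) l \<noteq> {}}))
          \<sim>[sequentially] (\<lambda>n. real (q n) ^ (t choose 2)))"
proof -
  have F: "field (F n)" "finite (carrier (F n))" for n
    using assms(3)[of n] by (auto simp: odd_finite_field_def)
  have q_pos: "real (q n) powr s > 0" for n s
  proof -
    interpret field "F n" by (rule F)
    have "card (carrier (F n)) > 0" using F(2)[of n] carrier_not_empty by (simp add: card_gt_0_iff)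
    then show ?thesis by (simp add: assms(4) order_def)
  qed
  show ?thesis
  proof (intro conjI impI allI)
    fix l
    assume small: "(\<lambda>n. real (q n) powr (real d / 2 + real t - 1)) \<in> o(\<lambda>n. real (card (E n)))"
      and l: "\<forall>n. l n \<in> parameters (F n) t"
    note ratio = smallo_pos_imp_ratio[OF small q_pos]
    show "(\<lambda>n. real (card (solutions (F n) t (E n) (B n) (l n))))
        \<sim>[sequentially] (\<lambda>n. real (card (E n)) ^ t / real (q n) ^ (t choose 2))"
    proof (rule asymp_equiv_of_relative_error[OF _ ratio(1)])
      show "eventually (\<lambda>n. \<bar>real (card (solutions (F n) t (E n) (B n) (l n)))
            - real (card (E n)) ^ t / real (q n) ^ (t choose 2)\<bar>
          \<le> 2 ^ (t choose 2) * (real (q n) powr (real d / 2 + real t - 1) / real (card (E n)))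
            * (real (card (E n)) ^ t / real (q n) ^ (t choose 2))) sequentially"
        using ratio(2)
      proof eventually_elim
        case (elim n)
        then show ?case
          unfolding assms(4) using assms l
          by (intro card_solutions_close[OF F]) auto
      qed
    qed simp
  next
    assume small: "(\<lambda>n. real (q n) powr ((real d + real t) / 2)) \<in> o(\<lambda>n. real (card (E n)))"
    note ratio = smallo_pos_imp_ratio[OF small q_pos]
    show "(\<lambda>n. real (card {l \<in> parameters (F n) t. solutions (F n) t (E n) (B n) l \<noteq> {}}))
        \<sim>[sequentially] (\<lambda>n. real (q n) ^ (t choose 2))"
    proof (rule asymp_equiv_of_relative_error[OF _ ratio(1)])
      show "eventually (\<lambda>n. \<bar>real (card {l \<in> parameters (F n) t. solutions (F n) t (E n) (B n) l \<noteq> {}})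
            - real (q n) ^ (t choose 2)\<bar>
          \<le> real (t choose 2) * (real (q n) powr ((real d + real t) / 2) / real (card (E n)))
            * real (q n) ^ (t choose 2)) sequentially"
        using ratio(2)
      proof eventually_elim
        case (elim n)
        then show ?case
          unfolding assms(4) using assms
          by (intro card_solvable_close[OF F]) auto
      qed
    qed simp
  qed
qed

end
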